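(* Let $\mathfrak g=\mathfrak{so}_{2r}(\mathbb C)$ with $r\ge 4$, and let $\lambda=\alpha_1+\alpha_2+\cdots+\alpha_r$ be the sum of its simple roots. Then $\sigma\in\mathcal A(\lambda,0)$ if and only if one of the following holds: (1) $\sigma=1$; or (2) $\sigma=s_{i_1}s_{i_2}\cdots s_{i_k}$ for some nonconsecutive integers $2\le i_1,i_2,\ldots,i_k\le r-2$; or (3) $\sigma=s_{i_1}s_{i_2}\cdots s_{i_k}\pi$ for some (possibly empty) collection of nonconsecutive integers $2\le i_1,i_2,\ldots,i_k\le r-5$ and some $\pi\in\{s_{r-3}s_{r-2},\ s_{r-2}s_{r-3},\ s_{r-3}s_{r-2}s_{r-3}\}$.
   Context: Let $\varepsilon_1,\ldots,\varepsilon_r$ be the standard basis of $\mathbb R^r$. The simple roots of $\mathfrak{so}_{2r}(\mathbb C)$ are $\alpha_i=\varepsilon_i-\varepsilon_{i+1}$ for $1\le i\le r-1$ and $\alpha_r=\varepsilon_{r-1}+\varepsilon_r$; the positive roots are $\Phi^+=\{\varepsilon_i-\varepsilon_j,\ \varepsilon_i+\varepsilon_j:1\le i<j\le r\}$. Set $\rho=\frac12\sum_{\alpha\in\Phi^+}\alpha$. The Weyl group $W$ is generated by the simple reflections $s_i$ in the hyperplanes orthogonal to $\alpha_i$, $1\le i\le r$. Kostant's partition function $\wp(\xi)$ is the number of ways to write $\xi$ as a nonnegative integral linear combination of positive roots (so $\wp(0)=1$). For integral weights $\lambda,\mu$ (not necessarily dominant), the Weyl alternation set is $\mathcal A(\lambda,\mu)=\{\sigma\in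 W:\wp(\sigma(\lambda+\rho)-(\mu+\rho))>0\}$. Integers $i_1,\ldots,i_k$ are nonconsecutive if $|i_a-i_b|\ge 2$ for all $a\ne b$.
   Formalization: Case (3) is asserted only for r ≥ 5: at r = 4 it would include s_1s_2, s_2s_1 and s_1s_2s_1, which are not in the alternation set, e.g. s_1s_2(λ+ρ)−ρ = (−1,2,1,0) has no partition; for r = 4 only cases (1) and (2) remain. *)

theory Defs
  imports Complex_Main "HOL-Library.Function_Algebras"
    "HOL-Algebra.Bij" "HOL-Algebra.Generated_Groups"
begin

text \<open>
  A vector of \<open>\<real>\<^sup>r\<close> is a function \<open>v :: nat \<Rightarrow> real\<close> with coordinates \<open>v 1, \<dots>, v r\<close> that vanishes
  at all other indices; \<open>+\<close>, \<open>-\<close>, \<open>0\<close> and sums of such functions are the pointwise ones of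
  \<^theory>\<open>HOL-Library.Function_Algebras\<close>.
\<close>

type_synonym vect = "nat \<Rightarrow> real"

definition scale_vec :: "real \<Rightarrow> vect \<Rightarrow> vect" where
  "scale_vec c v = (\<lambda>k. c * v k)"

definition inner_vec :: "nat \<Rightarrow> vect \<Rightarrow> vect \<Rightarrow> real" where
  "inner_vec r v w = (\<Sum>k = 1..r. v k * w k)"

definition eps :: "nat \<Rightarrow> vect" where
  "eps i = (\<lambda>k. if k = i then 1 else 0)"

definition simple_root :: "nat \<Rightarrow> nat \<Rightarrow> vect" where
  "simple_root r i = (if i < r then eps i - eps (i + 1) else eps (r - 1) + eps r)"

definition positive_roots :: "nat \<Rightarrow> vect set" where
  "positive_roots r =
     {eps i - eps j | i j. 1 \<le> i \<and> i < j \<and> j \<le> r} \<union>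
     {eps i + eps j | i j. 1 \<le> i \<and> i < j \<and> j \<le> r}"

definition weyl_vector :: "nat \<Rightarrow> vect" where
  "weyl_vector r = scale_vec (1 / 2) (\<Sum>\<alpha>\<in>positive_roots r. \<alpha>)"

definition simple_reflection :: "nat \<Rightarrow> nat \<Rightarrow> vect \<Rightarrow> vect" where
  "simple_reflection r i v =
     v - scale_vec (2 * inner_vec r v (simple_root r i) /
                    inner_vec r (simple_root r i) (simple_root r i)) (simple_root r i)"

text \<open>
  The reflections are defined on all functions and fix every coordinate outside \<open>1, \<dots>, r\<close>.
  Hence an element of the group they generate is determined by its action on \<open>\<real>\<^sup>r\<close>, and the
  generated group of bijections is the Weyl group.
\<close>

definition weyl_group :: "nat \<Rightarrow> (vect \<Rightarrow> vect) set" where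
  "weyl_group r = generate (BijGroup UNIV) (simple_reflection r ` {1..r})"

text \<open>
  A way of writing \<open>\<xi>\<close> as a combination of positive roots is a coefficient function \<open>c\<close>; it is set
  to \<open>0\<close> off the positive roots so that distinct functions are distinct combinations. As the
  positive roots lie in an open half-space, there are only finitely many such \<open>c\<close>.
\<close>

definition kostant_partition :: "nat \<Rightarrow> vect \<Rightarrow> nat" where
  "kostant_partition r \<xi> =
     card {c :: vect \<Rightarrow> nat. (\<forall>\<alpha>. \<alpha> \<notin> positive_roots r \<longrightarrow> c \<alpha> = 0) \<and>
            \<xi> = (\<Sum>\<alpha>\<in>positive_roots r. scale_vec (real (c \<alpha>)) \<alpha>)}"

definition weyl_alternation_set :: "nat \<Rightarrow> vect \<Rightarrow> vect \<Rightarrow> (vect \<Rightarrow> vect) set" where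
  "weyl_alternation_set r l m =
     {\<sigma> \<in> weyl_group r.
        kostant_partition r (\<sigma> (l + weyl_vector r) - (m + weyl_vector r)) > 0}"

text \<open>A list \<open>[i\<^sub>1, \<dots>, i\<^sub>k]\<close> stands for \<open>s\<^bsub>i\<^sub>1\<^esub> \<circ> \<dots> \<circ> s\<^bsub>i\<^sub>k\<^esub>\<close>, so the last reflection acts first.\<close>

definition reflection_word :: "nat \<Rightarrow> nat list \<Rightarrow> vect \<Rightarrow> vect" where
  "reflection_word r js = foldr (\<circ>) (map (simple_reflection r) js) id"

definition nonconsecutive :: "nat list \<Rightarrow> bool" where
  "nonconsecutive js \<longleftrightarrow>
     (\<forall>a < length js. \<forall>b < length js. a \<noteq> b \<longrightarrow> \<bar>int (js ! a) - int (js ! b)\<bar> \<ge> 2)"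

end

theory Submission
  imports Defs "HOL-Combinatorics.Permutations"
begin

text \<open>
  Write \<open>\<lambda>\<close> for the sum of the simple roots. Then \<open>\<lambda> = \<epsilon>\<^sub>1 + \<epsilon>\<^bsub>r-1\<^esub>\<close> and \<open>\<rho> = (r-1, r-2, \<dots>, 1, 0)\<close>, so
  that \<open>\<lambda> + \<rho> = (r, r-2, r-3, \<dots>, 3, 2, 2, 0)\<close>, and the Weyl group acts by permutations of the
  coordinates combined with an even number of sign changes.

  \<^bold>\<open>Necessity.\<close> A vector \<open>\<xi>\<close> with a positive partition function pairs nonnegatively with every
  dominant vector (\<open>inner_dominant_nonneg\<close>). Apply this to \<open>\<xi> = \<sigma> (\<lambda> + \<rho>) - \<rho>\<close>. The coordinates
  of \<open>\<xi>\<close> have a nonnegative total; it is \<open>2\<close> if \<open>\<sigma>\<close> changes no sign, and each sign change at a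
  coordinate of size at least \<open>2\<close> lowers it by at least \<open>4\<close>.
  Hence only the coordinate \<open>0\<close> could change its sign, and by parity \<open>\<sigma>\<close> is a pure permutation.
  The first coordinate has to stay \<open>r\<close>, the last one has to stay \<open>0\<close>, and in between each partial
  sum of \<open>\<sigma> (\<lambda> + \<rho>)\<close> may fall below that of \<open>\<lambda> + \<rho>\<close> by at most \<open>1\<close>
  (\<open>alternation_permutation\<close>). Reading the coordinates from the left, the first displaced one
  can then only be exchanged with its right neighbour; doing so uses up the allowance of \<open>1\<close>, so the
  neighbour must receive the displaced value, and the scan continues behind the pair
  (\<open>small_deficit_words\<close>). This yields nonconsecutive simple reflections. The scan changes character
  only when it reaches the coordinates \<open>3, 2, 2\<close> at the places \<open>r-3, r-2, r-1\<close>: no arrangement of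
  these three exceeds the allowance, so all six permutations occur, and three of them are not
  products of nonconsecutive reflections.

  \<^bold>\<open>Sufficiency.\<close> A product of nonconsecutive reflections \<open>s\<^sub>i\<close> with \<open>2 \<le> i \<le> r-3\<close> subtracts the sum of the
  corresponding \<open>\<alpha>\<^sub>i\<close> from \<open>\<lambda> + \<rho>\<close>, the reflection \<open>s\<^bsub>r-2\<^esub>\<close> fixes \<open>\<lambda> + \<rho>\<close>, and the three exceptional
  factors subtract \<open>\<alpha>\<^bsub>r-3\<^esub>\<close> or \<open>\<alpha>\<^bsub>r-3\<^esub> + \<alpha>\<^bsub>r-2\<^esub>\<close>. In all cases \<open>\<sigma> (\<lambda> + \<rho>) - \<rho>\<close> is \<open>\<lambda>\<close> with some distinct
  simple roots deleted, hence again a sum of simple roots.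
\<close>

section \<open>Coordinates of roots, \<open>\<rho>\<close> and \<open>\<lambda> + \<rho>\<close>\<close>

lemma sum_vect_apply: "(\<Sum>a\<in>A. f a) k = (\<Sum>a\<in>A. (f a :: vect) k)"
  by (induction A rule: infinite_finite_induct) auto

lemma finite_positive_roots: "finite (positive_roots r)"
proof -
  have "positive_roots r \<subseteq> (\<lambda>(i, j). eps i - eps j) ` ({1..r} \<times> {1..r}) \<union>
      (\<lambda>(i, j). eps i + eps j) ` ({1..r} \<times> {1..r})"
    unfolding positive_roots_def by force
  then show ?thesis
    by (rule finite_subset) auto
qed

text \<open>
  A root is determined by its support \<open>{i, j}\<close> and the sign of its second coordinate. This makes the
  parametrisations of the positive and of the simple roots injective.
\<close>
lemma eps_pair_eqD:
  assumes "i < j" "i' < j'" and "\<bar>c\<bar> = 1" "\<bar>d\<bar> = 1"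
    and eq: "\<And>k. eps i k + c * eps j k = eps i' k + d * eps j' k"
  shows "i = i' \<and> j = j' \<and> c = d"
proof -
  have supp: "{k. eps i k + c * eps j k \<noteq> 0} = {i, j}" "{k. eps i' k + d * eps j' k \<noteq> 0} = {i', j'}"
    using assms(1-4) by (auto simp: eps_def)
  then have "{i, j} = {i', j'}"
    using eq by simp
  then have "i = i'" "j = j'"
    using assms(1,2) by (auto simp: doubleton_eq_iff)
  moreover have "c = d"
    using eq[of j] \<open>i = i'\<close> \<open>j = j'\<close> assms(1) by (simp add: eps_def)
  ultimately show ?thesis by simp
qed

text \<open>
  In the sum of the positive roots, \<open>\<epsilon>\<^sub>i - \<epsilon>\<^sub>j\<close> and \<open>\<epsilon>\<^sub>i + \<epsilon>\<^sub>j\<close> combine to \<open>2 \<epsilon>\<^sub>i\<close>, and \<open>i\<close> is the smaller index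
  of exactly \<open>r - i\<close> pairs.
\<close>
lemma weyl_vector_apply: "weyl_vector r k = (if 1 \<le> k \<and> k \<le> r then real (r - k) else 0)"
proof -
  define P where "P = Sigma {1..r} (\<lambda>i. {i<..r})"
  define dif sm where "dif = (\<lambda>(i, j). eps i - eps j)" and "sm = (\<lambda>(i, j). eps i + eps j)"
  have roots: "positive_roots r = dif ` P \<union> sm ` P"
    unfolding positive_roots_def dif_def sm_def P_def by force
  have inj_dif: "inj_on dif P"
  proof (rule inj_onI)
    fix x y assume "x \<in> P" "y \<in> P" "dif x = dif y"
    then show "x = y"
      using eps_pair_eqD[of "fst x" "snd x" "fst y" "snd y" "-1" "-1"]
      by (cases x; cases y) (auto simp: dif_def P_def fun_eq_iff)
  qed
  have inj_sm: "inj_on sm P"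
  proof (rule inj_onI)
    fix x y assume "x \<in> P" "y \<in> P" "sm x = sm y"
    then show "x = y"
      using eps_pair_eqD[of "fst x" "snd x" "fst y" "snd y" 1 1]
      by (cases x; cases y) (auto simp: sm_def P_def fun_eq_iff)
  qed
  have disj: "dif ` P \<inter> sm ` P = {}"
  proof (rule ccontr)
    assume "dif ` P \<inter> sm ` P \<noteq> {}"
    then obtain x y where "x \<in> P" "y \<in> P" "dif x = sm y" by blast
    then show False
      using eps_pair_eqD[of "fst x" "snd x" "fst y" "snd y" "-1" 1]
      by (cases x; cases y) (auto simp: dif_def sm_def P_def fun_eq_iff)
  qed
  have finP: "finite P" by (simp add: P_def)
  have "(\<Sum>\<alpha>\<in>positive_roots r. \<alpha> k) = (\<Sum>x\<in>P. dif x k) + (\<Sum>x\<in>P. sm x k)"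
    unfolding roots using finP
    by (simp add: sum.union_disjoint disj sum.reindex inj_dif inj_sm)
  also have "\<dots> = (\<Sum>x\<in>P. 2 * eps (fst x) k)"
    unfolding sum.distrib[symmetric]
    by (rule sum.cong) (auto simp: dif_def sm_def)
  also have "\<dots> = (\<Sum>i\<in>{1..r}. \<Sum>j\<in>{i<..r}. 2 * eps i k)"
    unfolding P_def by (subst sum.Sigma) (auto intro!: sum.cong)
  also have "\<dots> = (\<Sum>i\<in>{1..r}. if i = k then 2 * real (r - k) else 0)"
    by (rule sum.cong) (auto simp: eps_def)
  also have "\<dots> = 2 * (if 1 \<le> k \<and> k \<le> r then real (r - k) else 0)"
    by simp
  finally show ?thesis
    by (simp add: weyl_vector_def scale_vec_def sum_vect_apply)
qed

lemma sum_simple_roots: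
  assumes "1 \<le> r"
  shows "(\<Sum>i = 1..r. simple_root r i) = eps 1 + eps (r - 1)"
proof -
  have "(\<Sum>i = 1..<r. simple_root r i) = (\<Sum>i = 1..<r. eps i - eps (Suc i))"
    by (rule sum.cong) (auto simp: simple_root_def)
  also have "\<dots> = - (\<Sum>i = 1..<r. eps (Suc i) - eps i)"
    by (simp add: sum_subtractf)
  also have "\<dots> = eps 1 - eps r"
    using assms by (simp add: sum_Suc_diff')
  finally have "(\<Sum>i = 1..<r. simple_root r i) = eps 1 - eps r" .
  moreover have "{1..r} = insert r {1..<r}" using assms by auto
  ultimately show ?thesis
    by (simp add: simple_root_def)
qed

definition shifted_weight :: "nat \<Rightarrow> vect" where
  "shifted_weight r = (\<Sum>i = 1..r. simple_root r i) + weyl_vector r"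

lemma shifted_weight_apply:
  assumes "4 \<le> r"
  shows "shifted_weight r k =
    (if k = 1 then real r else if k = r - 1 then 2
     else if 1 \<le> k \<and> k \<le> r then real (r - k) else 0)"
proof -
  have "1 \<le> r" using assms by simp
  then show ?thesis
    unfolding shifted_weight_def sum_simple_roots[OF \<open>1 \<le> r\<close>] using assms
    by (auto simp: weyl_vector_apply eps_def of_nat_diff)
qed

section \<open>The Weyl group as even signed permutations\<close>

lemma simple_reflection_below:
  assumes "1 \<le> i" "i < r"
  shows "simple_reflection r i x = x - scale_vec (x i - x (i + 1)) (simple_root r i)"
proof -
  have "inner_vec r y (simple_root r i) = y i - y (i + 1)" for y
  proof -
    have "inner_vec r y (simple_root r i) =
        (\<Sum>k = 1..r. (if k = i then y k else 0) - (if k = i + 1 then y k else 0))"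
      unfolding inner_vec_def using assms
      by (intro sum.cong) (auto simp: simple_root_def eps_def)
    also have "\<dots> = y i - y (i + 1)"
      using assms by (simp add: sum_subtractf)
    finally show ?thesis .
  qed
  then show ?thesis
    using assms by (simp add: simple_reflection_def simple_root_def eps_def diff_divide_distrib)
qed

lemma simple_reflection_transpose:
  assumes "1 \<le> i" "i < r"
  shows "simple_reflection r i x = x \<circ> transpose i (i + 1)"
  unfolding simple_reflection_below[OF assms] using assms
  by (auto simp: fun_eq_iff scale_vec_def simple_root_def eps_def transpose_def)

lemma simple_reflection_last:
  assumes "2 \<le> r"
  shows "simple_reflection r r x k = (if k = r - 1 \<or> k = r then - 1 else 1) * x (transpose (r - 1) r k)"
proof -
  have "inner_vec r y (simple_root r r) = y (r - 1) + y r" for y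
  proof -
    have "inner_vec r y (simple_root r r) =
        (\<Sum>k = 1..r. (if k = r - 1 then y k else 0) + (if k = r then y k else 0))"
      unfolding inner_vec_def using assms
      by (intro sum.cong) (auto simp: simple_root_def eps_def)
    also have "\<dots> = y (r - 1) + y r"
      using assms by (simp add: sum.distrib) (auto simp: Suc_le_eq)
    finally show ?thesis .
  qed
  then show ?thesis
    using assms
    by (auto simp: simple_reflection_def simple_root_def eps_def scale_vec_def transpose_def add_divide_distrib)
qed

lemma simple_reflection_involution:
  assumes "2 \<le> r" "i \<in> {1..r}"
  shows "simple_reflection r i \<circ> simple_reflection r i = id"
proof (cases "i = r")
  case True
  show ?thesis
    unfolding True fun_eq_iff
    using assms by (auto simp: simple_reflection_last transpose_def)
next
  case False
  then show ?thesis
    using assms by (auto simp: fun_eq_iff simple_reflection_transpose)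
qed

text \<open>
  The pair \<open>(p, e)\<close> stands for the map \<open>x \<mapsto> (\<lambda>k. e k * x (p k))\<close>. The permutation moves indices, not
  coordinates, so that composing two such maps composes the permutations in the opposite order.
\<close>
definition even_signed_permutation :: "nat \<Rightarrow> (nat \<Rightarrow> nat) \<Rightarrow> (nat \<Rightarrow> real) \<Rightarrow> bool" where
  "even_signed_permutation r p e \<longleftrightarrow> p permutes {1..r} \<and> (\<forall>k. e k = 1 \<or> e k = - 1) \<and>
     (\<forall>k. k \<notin> {1..r} \<longrightarrow> e k = 1) \<and> prod e {1..r} = 1"

lemma simple_reflection_even_signed:
  assumes "2 \<le> r" "i \<in> {1..r}"
  shows "\<exists>p e. even_signed_permutation r p e \<and> simple_reflection r i = (\<lambda>x k. e k * x (p k))"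
proof (cases "i = r")
  case True
  define e where "e k = (if k = r - 1 \<or> k = r then - 1 else 1 :: real)" for k
  have "prod e {1..r} = prod e {r - 1, r}"
    using assms by (intro prod.mono_neutral_right) (auto simp: e_def)
  also have "\<dots> = 1"
    using assms by (auto simp: e_def)
  finally have "even_signed_permutation r (transpose (r - 1) r) e"
    using assms unfolding even_signed_permutation_def
    by (auto simp: e_def intro!: permutes_swap_id)
  moreover have "simple_reflection r i = (\<lambda>x k. e k * x (transpose (r - 1) r k))"
    using assms by (simp add: fun_eq_iff True simple_reflection_last e_def)
  ultimately show ?thesis by (intro exI conjI)
next
  case False
  have "even_signed_permutation r (transpose i (i + 1)) (\<lambda>_. 1)"
    using assms False unfolding even_signed_permutation_def
    by (auto intro!: permutes_swap_id)
  moreover have "simple_reflection r i = (\<lambda>x k. 1 * x (transpose i (i + 1) k))"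
    using assms False by (simp add: fun_eq_iff simple_reflection_transpose)
  ultimately show ?thesis by (intro exI conjI)
qed

lemma even_signed_permutation_compose:
  assumes "even_signed_permutation r p e" "even_signed_permutation r q f"
  shows "even_signed_permutation r (q \<circ> p) (\<lambda>k. e k * f (p k))"
proof -
  have p: "p permutes {1..r}" and q: "q permutes {1..r}"
    and e: "\<And>k. e k = 1 \<or> e k = - 1" "\<And>k. k \<notin> {1..r} \<Longrightarrow> e k = 1" "prod e {1..r} = 1"
    and f: "\<And>k. f k = 1 \<or> f k = - 1" "\<And>k. k \<notin> {1..r} \<Longrightarrow> f k = 1" "prod f {1..r} = 1"
    using assms by (auto simp: even_signed_permutation_def)
  have "(\<Prod>k\<in>{1..r}. f (p k)) = 1"
    using prod.permute[OF p, of f] f(3) by (simp add: o_def)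
  then have "(\<Prod>k\<in>{1..r}. e k * f (p k)) = 1"
    using e(3) by (simp add: prod.distrib)
  moreover have "e k * f (p k) = 1 \<or> e k * f (p k) = - 1" for k
    using e(1)[of k] f(1)[of "p k"] by auto
  moreover have "e k * f (p k) = 1" if "k \<notin> {1..r}" for k
    using e(2)[OF that] f(2)[OF that] permutes_not_in[OF p that] by simp
  moreover have "q \<circ> p permutes {1..r}"
    by (rule permutes_compose[OF p q])
  ultimately show ?thesis
    unfolding even_signed_permutation_def by blast
qed

lemma simple_reflection_in_Bij:
  assumes "2 \<le> r" "i \<in> {1..r}"
  shows "simple_reflection r i \<in> Bij UNIV"
  using o_bij[OF simple_reflection_involution[OF assms] simple_reflection_involution[OF assms]]
  by (simp add: Bij_def)

lemma inv_BijGroup_simple_reflection: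
  assumes "2 \<le> r" "i \<in> {1..r}"
  shows "inv\<^bsub>BijGroup UNIV\<^esub> (simple_reflection r i) = simple_reflection r i"
proof (rule group.inv_equality[OF group_BijGroup])
  show "simple_reflection r i \<otimes>\<^bsub>BijGroup UNIV\<^esub> simple_reflection r i = \<one>\<^bsub>BijGroup UNIV\<^esub>"
    using simple_reflection_involution[OF assms] simple_reflection_in_Bij[OF assms]
    by (simp add: BijGroup_def compose_def fun_eq_iff)
qed (use simple_reflection_in_Bij[OF assms] in \<open>auto simp: BijGroup_def\<close>)

lemma weyl_group_in_Bij:
  assumes "2 \<le> r" "\<sigma> \<in> weyl_group r"
  shows "\<sigma> \<in> Bij UNIV"
proof -
  have "generate (BijGroup UNIV) (simple_reflection r ` {1..r}) \<subseteq> carrier (BijGroup UNIV)"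
    using simple_reflection_in_Bij[OF assms(1)]
    by (intro group.generate_incl[OF group_BijGroup]) (auto simp: BijGroup_def)
  then show ?thesis
    using assms(2) by (auto simp: weyl_group_def BijGroup_def)
qed

lemma weyl_group_even_signed:
  assumes "2 \<le> r" "\<sigma> \<in> weyl_group r"
  shows "\<exists>p e. even_signed_permutation r p e \<and> \<sigma> = (\<lambda>x k. e k * x (p k))"
  using assms(2) unfolding weyl_group_def
proof (induction rule: generate.induct)
  case one
  have "even_signed_permutation r id (\<lambda>_. 1)"
    by (simp add: even_signed_permutation_def permutes_id)
  moreover have "\<one>\<^bsub>BijGroup UNIV\<^esub> = (\<lambda>(x :: vect) k. 1 * x (id k))"
    by (simp add: BijGroup_def fun_eq_iff)
  ultimately show ?case by blast
next
  case (incl h)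
  then show ?case
    using simple_reflection_even_signed[OF assms(1)] by blast
next
  case (inv h)
  then obtain i where "i \<in> {1..r}" "h = simple_reflection r i" by blast
  then show ?case
    using simple_reflection_even_signed[OF assms(1)] inv_BijGroup_simple_reflection[OF assms(1)]
    by simp
next
  case (eng h1 h2)
  obtain p e q f where signed: "even_signed_permutation r p e" "even_signed_permutation r q f"
    and h: "h1 = (\<lambda>x k. e k * x (p k))" "h2 = (\<lambda>x k. f k * x (q k))"
    using eng.IH by blast
  have "h1 \<in> Bij UNIV" "h2 \<in> Bij UNIV"
    using eng.hyps weyl_group_in_Bij[OF assms(1)] by (auto simp: weyl_group_def)
  then have "h1 \<otimes>\<^bsub>BijGroup UNIV\<^esub> h2 = (\<lambda>x. h1 (h2 x))"
    by (simp add: BijGroup_def compose_def fun_eq_iff)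
  also have "\<dots> = (\<lambda>x k. (e k * f (p k)) * x ((q \<circ> p) k))"
    by (simp add: h mult.assoc)
  finally show ?case
    using even_signed_permutation_compose[OF signed] by blast
qed

lemma reflection_word_Nil: "reflection_word r [] = id"
  by (simp add: reflection_word_def)

lemma reflection_word_Cons:
  "reflection_word r (i # js) = simple_reflection r i \<circ> reflection_word r js"
  by (simp add: reflection_word_def)

lemma weyl_group_compose:
  assumes "2 \<le> r" "\<sigma> \<in> weyl_group r" "\<tau> \<in> weyl_group r"
  shows "\<sigma> \<circ> \<tau> \<in> weyl_group r"
proof -
  have "\<sigma> \<otimes>\<^bsub>BijGroup UNIV\<^esub> \<tau> \<in> weyl_group r"
    using assms generate.eng unfolding weyl_group_def by fast
  moreover have "\<sigma> \<otimes>\<^bsub>BijGroup UNIV\<^esub> \<tau> = \<sigma> \<circ> \<tau>"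
    using weyl_group_in_Bij[OF assms(1)] assms(2,3)
    by (simp add: BijGroup_def compose_def fun_eq_iff)
  ultimately show ?thesis by simp
qed

lemma reflection_word_in_weyl_group:
  assumes "2 \<le> r" "set js \<subseteq> {1..r}"
  shows "reflection_word r js \<in> weyl_group r"
  using assms(2)
proof (induction js)
  case Nil
  have "\<one>\<^bsub>BijGroup UNIV\<^esub> \<in> weyl_group r"
    unfolding weyl_group_def by (rule generate.one)
  moreover have "\<one>\<^bsub>BijGroup UNIV\<^esub> = (id :: vect \<Rightarrow> vect)"
    by (simp add: BijGroup_def fun_eq_iff)
  ultimately show ?case by (metis reflection_word_Nil)
next
  case (Cons i js)
  moreover have "simple_reflection r i \<in> weyl_group r"
    unfolding weyl_group_def using Cons.prems by (intro generate.incl) auto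
  ultimately show ?case
    unfolding reflection_word_Cons by (intro weyl_group_compose[OF assms(1)]) auto
qed

section \<open>Positivity of the partition function\<close>

lemma inner_vec_sum_scale:
  "inner_vec r u (\<Sum>a\<in>A. scale_vec (c a) a) = (\<Sum>a\<in>A. c a * inner_vec r u a)"
proof -
  have "inner_vec r u (\<Sum>a\<in>A. scale_vec (c a) a) = (\<Sum>k = 1..r. \<Sum>a\<in>A. c a * (u k * a k))"
    by (simp add: inner_vec_def sum_vect_apply scale_vec_def sum_distrib_left mult_ac)
  also have "\<dots> = (\<Sum>a\<in>A. \<Sum>k = 1..r. c a * (u k * a k))"
    by (rule sum.swap)
  finally show ?thesis
    by (simp add: inner_vec_def sum_distrib_left)
qed

lemma inner_vec_eps_pair:
  assumes "i \<in> {1..r}" "j \<in> {1..r}"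
  shows "inner_vec r u (eps i - eps j) = u i - u j" "inner_vec r u (eps i + eps j) = u i + u j"
proof -
  have "u k * eps i k = (if k = i then u k else 0)" for i k by (simp add: eps_def)
  then show "inner_vec r u (eps i - eps j) = u i - u j" "inner_vec r u (eps i + eps j) = u i + u j"
    using assms by (auto simp: inner_vec_def algebra_simps sum_subtractf sum.distrib)
qed

lemma inner_positive_root_ge:
  assumes "\<And>i j. 1 \<le> i \<Longrightarrow> i < j \<Longrightarrow> j \<le> r \<Longrightarrow> c + \<bar>u j\<bar> \<le> u i" and "\<alpha> \<in> positive_roots r"
  shows "c \<le> inner_vec r u \<alpha>"
proof -
  from assms(2) obtain i j where ij: "1 \<le> i" "i < j" "j \<le> r" "\<alpha> = eps i - eps j \<or> \<alpha> = eps i + eps j"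
    unfolding positive_roots_def by blast
  then have "inner_vec r u \<alpha> = u i - u j \<or> inner_vec r u \<alpha> = u i + u j"
    using inner_vec_eps_pair[of i r j u] by auto
  then show ?thesis
    using assms(1)[OF ij(1-3)] by linarith
qed

text \<open>
  The hypothesis says that \<open>u\<close> is dominant, that is, pairs nonnegatively with the positive roots.
\<close>
lemma inner_dominant_nonneg:
  assumes "kostant_partition r \<xi> > 0"
    and "\<And>i j. 1 \<le> i \<Longrightarrow> i < j \<Longrightarrow> j \<le> r \<Longrightarrow> \<bar>u j\<bar> \<le> u i"
  shows "0 \<le> inner_vec r u \<xi>"
proof -
  from assms(1) obtain c :: "vect \<Rightarrow> nat"
    where "\<xi> = (\<Sum>\<alpha>\<in>positive_roots r. scale_vec (real (c \<alpha>)) \<alpha>)"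
    unfolding kostant_partition_def card_gt_0_iff by blast
  moreover have "0 \<le> inner_vec r u \<alpha>" if "\<alpha> \<in> positive_roots r" for \<alpha>
    using inner_positive_root_ge[of r 0 u \<alpha>] assms(2) that by simp
  ultimately show ?thesis
    by (simp add: inner_vec_sum_scale sum_nonneg)
qed

text \<open>
  A cardinality is positive only for a finite set, so the finiteness of the set of partitions
  matters here: the pairing with \<open>\<rho>\<close> is at least \<open>1\<close> on every positive root, so the pairing of
  \<open>\<xi>\<close> with \<open>\<rho>\<close> bounds all coefficients.
\<close>
lemma kostant_partition_positiveI:
  assumes "\<And>\<alpha>. \<alpha> \<notin> positive_roots r \<Longrightarrow> c \<alpha> = (0 :: nat)"
    and "\<xi> = (\<Sum>\<alpha>\<in>positive_roots r. scale_vec (real (c \<alpha>)) \<alpha>)"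
  shows "kostant_partition r \<xi> > 0"
proof -
  let ?C = "{c :: vect \<Rightarrow> nat. (\<forall>\<alpha>. \<alpha> \<notin> positive_roots r \<longrightarrow> c \<alpha> = 0) \<and>
            \<xi> = (\<Sum>\<alpha>\<in>positive_roots r. scale_vec (real (c \<alpha>)) \<alpha>)}"
  define h where "h = inner_vec r (weyl_vector r)"
  have h: "1 \<le> h \<alpha>" if "\<alpha> \<in> positive_roots r" for \<alpha>
    unfolding h_def using that by (intro inner_positive_root_ge) (auto simp: weyl_vector_apply)
  have "d \<alpha> \<in> {..nat \<lfloor>h \<xi>\<rfloor>}" if d: "d \<in> ?C" and \<alpha>: "\<alpha> \<in> positive_roots r" for d \<alpha>
  proof -
    have nonneg: "0 \<le> real (d \<beta>) * h \<beta>" if "\<beta> \<in> positive_roots r" for \<beta>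
      using h[OF that] by simp
    have "real (d \<alpha>) * 1 \<le> real (d \<alpha>) * h \<alpha>"
      using h[OF \<alpha>] by (intro mult_left_mono) auto
    also have "\<dots> \<le> (\<Sum>\<beta>\<in>positive_roots r. real (d \<beta>) * h \<beta>)"
      using member_le_sum[of \<alpha> "positive_roots r" "\<lambda>\<beta>. real (d \<beta>) * h \<beta>"] nonneg \<alpha>
        finite_positive_roots by blast
    also have "\<dots> = h \<xi>"
    proof -
      have "\<xi> = (\<Sum>\<alpha>\<in>positive_roots r. scale_vec (real (d \<alpha>)) \<alpha>)" using d by blast
      then show ?thesis unfolding h_def by (simp only: inner_vec_sum_scale)
    qed
    finally have "real (d \<alpha>) \<le> h \<xi>" by simp
    then show ?thesis by (simp add: le_nat_floor)
  qed
  then have "?C \<subseteq> {f. \<forall>\<alpha>. (\<alpha> \<in> positive_roots r \<longrightarrow> f \<alpha> \<in> {..nat \<lfloor>h \<xi>\<rfloor>}) \<and>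
      (\<alpha> \<notin> positive_roots r \<longrightarrow> f \<alpha> = 0)}" by blast
  then have "finite ?C"
    by (rule finite_subset)
      (rule finite_set_of_finite_funs[OF finite_positive_roots], simp)
  moreover have "c \<in> ?C" using assms by blast
  ultimately show ?thesis
    unfolding kostant_partition_def card_gt_0_iff by blast
qed

lemma simple_root_positive:
  assumes "2 \<le> r" "i \<in> {1..r}"
  shows "simple_root r i \<in> positive_roots r"
proof (cases "i < r")
  case True
  then have "simple_root r i = eps i - eps (i + 1) \<and> 1 \<le> i \<and> i < i + 1 \<and> i + 1 \<le> r"
    using assms by (auto simp: simple_root_def)
  then show ?thesis unfolding positive_roots_def by blast
next
  case False
  then have "simple_root r i = eps (r - 1) + eps r \<and> 1 \<le> r - 1 \<and> r - 1 < r \<and> r \<le> r"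
    using assms by (auto simp: simple_root_def)
  then show ?thesis unfolding positive_roots_def by blast
qed

lemma inj_on_simple_root:
  assumes "2 \<le> r"
  shows "inj_on (simple_root r) {1..r}"
proof (rule inj_onI)
  fix i j assume ij: "i \<in> {1..r}" "j \<in> {1..r}" "simple_root r i = simple_root r j"
  have root: "\<exists>i' j' c. simple_root r i = (\<lambda>k. eps i' k + c * eps j' k) \<and> \<bar>c\<bar> = 1 \<and> i' < j' \<and>
      (c = -1 \<and> i' = i \<and> i < r \<or> c = 1 \<and> i = r)" if "i \<in> {1..r}" for i
  proof (cases "i < r")
    case True
    then show ?thesis
      by (intro exI[of _ i] exI[of _ "i + 1"] exI[of _ "-1"]) (auto simp: simple_root_def fun_eq_iff)
  next
    case False
    then show ?thesis using that assms
      by (intro exI[of _ "r - 1"] exI[of _ r] exI[of _ "1"]) (auto simp: simple_root_def fun_eq_iff)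
  qed
  obtain i1 i2 c where i: "simple_root r i = (\<lambda>k. eps i1 k + c * eps i2 k)" "\<bar>c\<bar> = 1" "i1 < i2"
    "c = -1 \<and> i1 = i \<and> i < r \<or> c = 1 \<and> i = r" using root[OF ij(1)] by blast
  obtain j1 j2 d where j: "simple_root r j = (\<lambda>k. eps j1 k + d * eps j2 k)" "\<bar>d\<bar> = 1" "j1 < j2"
    "d = -1 \<and> j1 = j \<and> j < r \<or> d = 1 \<and> j = r" using root[OF ij(2)] by blast
  have "i1 = j1 \<and> i2 = j2 \<and> c = d"
    using eps_pair_eqD[of i1 i2 j1 j2 c d] i j ij(3) by (simp add: fun_eq_iff)
  then show "i = j" using i(4) j(4) by auto
qed

lemma kostant_partition_sum_simple_roots:
  assumes "2 \<le> r" "I \<subseteq> {1..r}"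
  shows "kostant_partition r (\<Sum>i\<in>I. simple_root r i) > 0"
proof (rule kostant_partition_positiveI)
  let ?R = "simple_root r ` I"
  have sub: "?R \<subseteq> positive_roots r"
    using simple_root_positive[OF assms(1)] assms(2) by blast
  then show "(if \<alpha> \<in> ?R then 1 else 0) = (0 :: nat)" if "\<alpha> \<notin> positive_roots r" for \<alpha>
    using that by auto
  have "(\<Sum>i\<in>I. simple_root r i) = (\<Sum>\<alpha>\<in>?R. \<alpha>)"
    using inj_on_subset[OF inj_on_simple_root[OF assms(1)] assms(2)] by (simp add: sum.reindex)
  also have "\<dots> = (\<Sum>\<alpha>\<in>positive_roots r. scale_vec (real (if \<alpha> \<in> ?R then 1 else 0)) \<alpha>)"
    using sub finite_positive_roots
    by (intro sum.mono_neutral_cong_left) (auto simp: scale_vec_def fun_eq_iff)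
  finally show "(\<Sum>i\<in>I. simple_root r i) =
      (\<Sum>\<alpha>\<in>positive_roots r. scale_vec (real (if \<alpha> \<in> ?R then 1 else 0)) \<alpha>)" .
qed

section \<open>Sufficiency: the listed elements delete simple roots from \<open>\<lambda>\<close>\<close>

lemma nonconsecutive_Nil: "nonconsecutive []"
  by (simp add: nonconsecutive_def)

lemma nonconsecutive_Cons:
  "nonconsecutive (i # js) \<longleftrightarrow> nonconsecutive js \<and> (\<forall>j\<in>set js. \<bar>int i - int j\<bar> \<ge> 2)"
  unfolding nonconsecutive_def length_Cons All_less_Suc2
  by (auto simp: all_set_conv_all_nth abs_minus_commute)

text \<open>
  Nonconsecutive reflections act on disjoint pairs of coordinates, so each of them subtracts the
  multiple of its root that it would subtract from \<open>x\<close> on its own.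
\<close>
lemma reflection_word_nonconsecutive:
  assumes "nonconsecutive js" "set js \<subseteq> {1..<r}"
  shows "reflection_word r js x =
    x - (\<Sum>i\<in>set js. scale_vec (x i - x (i + 1)) (simple_root r i))"
  using assms
proof (induction js)
  case Nil
  then show ?case by (simp add: reflection_word_Nil)
next
  case (Cons i js)
  let ?y = "x - (\<Sum>i\<in>set js. scale_vec (x i - x (i + 1)) (simple_root r i))"
  have far: "2 \<le> \<bar>int i - int j\<bar>" "j < r" if "j \<in> set js" for j
    using Cons.prems that by (auto simp: nonconsecutive_Cons)
  have IH: "reflection_word r js x = ?y"
    using Cons by (auto simp: nonconsecutive_Cons)
  have "scale_vec c (simple_root r j) i = 0 \<and> scale_vec c (simple_root r j) (i + 1) = 0"
    if "j \<in> set js" for j c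
    using far[OF that] by (auto simp: scale_vec_def simple_root_def eps_def)
  then have "?y i = x i" "?y (i + 1) = x (i + 1)"
    by (simp_all add: sum_vect_apply)
  moreover have "i \<notin> set js" using far by force
  ultimately show ?case
    using Cons.prems
    by (simp add: reflection_word_Cons IH simple_reflection_below algebra_simps)
qed

lemma shifted_weight_descent:
  assumes "4 \<le> r" "2 \<le> i" "i \<le> r - 2"
  shows "shifted_weight r i - shifted_weight r (i + 1) = (if i = r - 2 then 0 else 1)"
  using assms by (auto simp: shifted_weight_apply of_nat_diff)

text \<open>
  Deleting distinct simple roots from \<open>\<lambda>\<close> leaves a sum of simple roots, which has a partition.
\<close>
lemma alternation_setI:
  assumes "4 \<le> r" "\<sigma> \<in> weyl_group r" "J \<subseteq> {1..r}"
    and "\<sigma> (shifted_weight r) = shifted_weight r - (\<Sum>i\<in>J. simple_root r i)"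
  shows "\<sigma> \<in> weyl_alternation_set r (\<Sum>i = 1..r. simple_root r i) 0"
proof -
  have "\<sigma> (shifted_weight r) - (0 + weyl_vector r) = (\<Sum>i\<in>{1..r} - J. simple_root r i)"
    using assms(3,4) by (simp add: shifted_weight_def sum_diff)
  then show ?thesis
    using assms(1,2) kostant_partition_sum_simple_roots[of r "{1..r} - J"]
    by (simp add: weyl_alternation_set_def shifted_weight_def)
qed

lemma nonconsecutive_word_in_alternation_set:
  assumes "4 \<le> r" "set js \<subseteq> {2..r - 2}" "nonconsecutive js"
  shows "reflection_word r js \<in> weyl_alternation_set r (\<Sum>i = 1..r. simple_root r i) 0"
proof (rule alternation_setI[OF assms(1)])
  let ?v = "shifted_weight r"
  have two: "2 \<le> r - 2" using assms(1) by simp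
  have range: "set js \<subseteq> {1..<r}" using assms by force
  then show "reflection_word r js \<in> weyl_group r"
    using assms(1) by (intro reflection_word_in_weyl_group) auto
  have "reflection_word r js ?v =
      ?v - (\<Sum>i\<in>set js. scale_vec (?v i - ?v (i + 1)) (simple_root r i))"
    by (rule reflection_word_nonconsecutive[OF assms(3) range])
  also have "(\<Sum>i\<in>set js. scale_vec (?v i - ?v (i + 1)) (simple_root r i)) =
      (\<Sum>i\<in>set js - {r - 2}. simple_root r i)"
  proof (rule sum.mono_neutral_cong_right)
    show "\<forall>i\<in>set js - (set js - {r - 2}). scale_vec (?v i - ?v (i + 1)) (simple_root r i) = 0"
      using shifted_weight_descent[OF assms(1) two order_refl]
      by (auto simp: scale_vec_def fun_eq_iff)
    show "scale_vec (?v i - ?v (i + 1)) (simple_root r i) = simple_root r i"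
      if "i \<in> set js - {r - 2}" for i
      using assms(2) that by (subst shifted_weight_descent) (auto simp: scale_vec_def assms(1))
  qed auto
  finally show "reflection_word r js ?v = ?v - (\<Sum>i\<in>set js - {r - 2}. simple_root r i)" .
  show "set js - {r - 2} \<subseteq> {1..r}" using range by auto
qed

text \<open>
  The two possible results of the three exceptional factors reflect that \<open>s\<^bsub>r-2\<^esub>\<close> fixes \<open>\<lambda> + \<rho>\<close>: the
  word \<open>s\<^bsub>r-3\<^esub> s\<^bsub>r-2\<^esub> s\<^bsub>r-3\<^esub> = s\<^bsub>r-2\<^esub> s\<^bsub>r-3\<^esub> s\<^bsub>r-2\<^esub>\<close> has the same effect as \<open>s\<^bsub>r-2\<^esub> s\<^bsub>r-3\<^esub>\<close>.
\<close>
lemma exceptional_factor_shifted_weight: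
  assumes "5 \<le> r"
    and "\<pi> \<in> {reflection_word r [r - 3, r - 2], reflection_word r [r - 2, r - 3],
               reflection_word r [r - 3, r - 2, r - 3]}"
  shows "\<exists>K. K \<subseteq> {r - 3, r - 2} \<and>
    \<pi> (shifted_weight r) = shifted_weight r - (\<Sum>i\<in>K. simple_root r i)"
proof -
  obtain a where r: "r = a + 3" and a: "2 \<le> a"
    using assms(1) by (intro that[of "r - 3"]) auto
  let ?v = "shifted_weight r"
  have v: "?v a = 3" "?v (a + 1) = 2" "?v (a + 2) = 2"
    using a by (auto simp: shifted_weight_apply r)
  have idx: "r - 3 = a" "r - 2 = a + 1" by (auto simp: r)
  have ref: "simple_reflection r a x = x \<circ> transpose a (a + 1)"
    "simple_reflection r (a + 1) x = x \<circ> transpose (a + 1) (a + 2)" for x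
    using a by (auto simp: simple_reflection_transpose r)
  have root: "simple_root r a = eps a - eps (a + 1)" "simple_root r (a + 1) = eps (a + 1) - eps (a + 2)"
    by (auto simp: simple_root_def r)
  note simps = reflection_word_Cons reflection_word_Nil ref[simplified] fun_eq_iff root[simplified]
    transpose_def eps_def v[simplified]
  from assms(2) consider "\<pi> = reflection_word r [a, a + 1]" | "\<pi> = reflection_word r [a + 1, a]" |
    "\<pi> = reflection_word r [a, a + 1, a]" unfolding idx by blast
  then show ?thesis
  proof cases
    case 1
    have "\<pi> ?v = ?v - (\<Sum>i\<in>{a}. simple_root r i)"
      unfolding 1 using v by (auto simp: simps)
    then show ?thesis unfolding idx by blast
  next
    case 2
    have "\<pi> ?v = ?v - (\<Sum>i\<in>{a, a + 1}. simple_root r i)"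
      unfolding 2 using v by (auto simp: simps)
    then show ?thesis unfolding idx by blast
  next
    case 3
    have "\<pi> ?v = ?v - (\<Sum>i\<in>{a, a + 1}. simple_root r i)"
      unfolding 3 using v by (auto simp: simps)
    then show ?thesis unfolding idx by blast
  qed
qed

lemma exceptional_word_in_alternation_set:
  assumes "5 \<le> r" "set js \<subseteq> {2..r - 5}" "nonconsecutive js"
    and \<pi>: "\<pi> \<in> {reflection_word r [r - 3, r - 2], reflection_word r [r - 2, r - 3],
               reflection_word r [r - 3, r - 2, r - 3]}"
  shows "reflection_word r js \<circ> \<pi> \<in> weyl_alternation_set r (\<Sum>i = 1..r. simple_root r i) 0"
proof -
  let ?v = "shifted_weight r"
  have r: "4 \<le> r" using assms(1) by simp
  obtain K where K: "K \<subseteq> {r - 3, r - 2}" "\<pi> ?v = ?v - (\<Sum>i\<in>K. simple_root r i)"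
    using exceptional_factor_shifted_weight[OF assms(1) \<pi>] by blast
  have range: "2 \<le> i" "i + 5 \<le> r" if "i \<in> set js" for i
    using subsetD[OF assms(2) that] assms(1) by auto
  have finK: "finite K"
    using K(1) by (rule finite_subset) simp
  have disj: "set js \<inter> K = {}"
  proof (rule ccontr)
    assume "set js \<inter> K \<noteq> {}"
    then obtain i where i: "i \<in> set js" "i \<in> K" by blast
    then have "i = r - 3 \<or> i = r - 2" using K(1) by blast
    then show False using range[OF i(1)] by auto
  qed
  have coeff: "scale_vec ((\<pi> ?v) i - (\<pi> ?v) (i + 1)) (simple_root r i) = simple_root r i"
    if "i \<in> set js" for i
  proof -
    have "simple_root r k i = 0 \<and> simple_root r k (i + 1) = 0" if "k \<in> K" for k
      using K(1) that range[OF \<open>i \<in> set js\<close>] by (auto simp: simple_root_def eps_def)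
    then have "(\<pi> ?v) i - (\<pi> ?v) (i + 1) = ?v i - ?v (i + 1)"
      unfolding K(2) by (simp add: sum_vect_apply)
    also have "\<dots> = 1"
      using range[OF that] by (subst shifted_weight_descent[OF r]) auto
    finally show ?thesis by (simp add: scale_vec_def)
  qed
  have "set js \<subseteq> {1..<r}" using range by force
  then have "reflection_word r js (\<pi> ?v) =
      \<pi> ?v - (\<Sum>i\<in>set js. scale_vec ((\<pi> ?v) i - (\<pi> ?v) (i + 1)) (simple_root r i))"
    by (rule reflection_word_nonconsecutive[OF assms(3)])
  also have "(\<Sum>i\<in>set js. scale_vec ((\<pi> ?v) i - (\<pi> ?v) (i + 1)) (simple_root r i)) =
      (\<Sum>i\<in>set js. simple_root r i)"
    by (rule sum.cong[OF refl coeff])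
  also have "\<pi> ?v - (\<Sum>i\<in>set js. simple_root r i) = ?v - (\<Sum>i\<in>set js \<union> K. simple_root r i)"
    using finK disj by (simp add: K(2) sum.union_disjoint algebra_simps)
  finally have word: "(reflection_word r js \<circ> \<pi>) ?v = ?v - (\<Sum>i\<in>set js \<union> K. simple_root r i)"
    by simp
  have "reflection_word r js \<in> weyl_group r"
    using range assms(1) by (intro reflection_word_in_weyl_group) fastforce+
  moreover have "\<pi> \<in> weyl_group r"
    using \<pi> assms(1) by (auto intro!: reflection_word_in_weyl_group)
  ultimately have "reflection_word r js \<circ> \<pi> \<in> weyl_group r"
    using r by (intro weyl_group_compose) auto
  moreover have "set js \<union> K \<subseteq> {1..r}"
  proof -
    have "K \<subseteq> {1..r}" using K(1) assms(1) by auto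
    then show ?thesis using range by fastforce
  qed
  ultimately show ?thesis
    using word by (intro alternation_setI[where J = "set js \<union> K", OF r])
qed

section \<open>Necessity: permutations with small deficits\<close>

text \<open>
  The three dominant vectors behind the conclusions are \<open>(1, \<dots>, 1)\<close>, which excludes sign changes,
  \<open>(1, \<dots>, 1, -1)\<close>, which keeps the last coordinate in place, and \<open>(1, \<dots>, 1, 0, \<dots>, 0)\<close>, which bounds the
  deficits of the partial sums.
\<close>
lemma alternation_permutation:
  assumes r: "4 \<le> r"
    and mem: "\<sigma> \<in> weyl_alternation_set r (\<Sum>i = 1..r. simple_root r i) 0"
  obtains p where "\<sigma> = (\<lambda>x. x \<circ> p)" "p permutes {2..r - 1}"
    "\<And>m. m \<le> r - 2 \<Longrightarrow>
       (\<Sum>j = 2..m. shifted_weight r j) \<le> (\<Sum>j = 2..m. shifted_weight r (p j)) + 1"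
proof -
  let ?v = "shifted_weight r"
  have v: "?v k = (if k = 1 then real r else if k = r - 1 then 2
     else if 1 \<le> k \<and> k \<le> r then real (r - k) else 0)" for k
    using r by (rule shifted_weight_apply)
  have v_nonneg: "0 \<le> ?v k" for k by (simp add: v)
  define \<xi> where "\<xi> = \<sigma> ?v - weyl_vector r"
  have W: "\<sigma> \<in> weyl_group r" and part: "kostant_partition r \<xi> > 0"
    using mem by (auto simp: weyl_alternation_set_def \<xi>_def shifted_weight_def)
  obtain p e where pe: "even_signed_permutation r p e" and \<sigma>: "\<sigma> = (\<lambda>x k. e k * x (p k))"
    using weyl_group_even_signed[OF _ W] r by auto
  have p: "p permutes {1..r}" and e: "\<And>k. e k = 1 \<or> e k = - 1" "\<And>k. k \<notin> {1..r} \<Longrightarrow> e k = 1"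
    "prod e {1..r} = 1"
    using pe by (auto simp: even_signed_permutation_def)
  have p_in: "p k \<in> {1..r} \<longleftrightarrow> k \<in> {1..r}" for k
    by (rule permutes_in_image[OF p])
  have \<xi>: "\<xi> k = e k * ?v (p k) - weyl_vector r k" for k
    by (simp add: \<xi>_def \<sigma>)
  have v_rho: "?v k = weyl_vector r k + (if k = 1 then 1 else 0) + (if k = r - 1 then 1 else 0)" for k
    using r by (auto simp: v weyl_vector_apply of_nat_diff)
  have sum_v: "(\<Sum>k = 1..r. ?v k) = (\<Sum>k = 1..r. weyl_vector r k) + 2"
    using r unfolding v_rho sum.distrib by (simp add: sum.distrib)
  have sum_vp: "(\<Sum>k = 1..r. ?v (p k)) = (\<Sum>k = 1..r. ?v k)"
    using sum.permute[OF p, of ?v] by (simp add: o_def)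
  have small: "?v k < 2 \<Longrightarrow> k \<in> {1..r} \<Longrightarrow> k = r" for k
    using r by (auto simp: v split: if_splits)

  \<comment> \<open>The total of the coordinates leaves no room for a sign change of a nonzero coordinate.\<close>
  have "0 \<le> inner_vec r (\<lambda>_. 1) \<xi>"
    using part by (rule inner_dominant_nonneg) simp
  then have "(\<Sum>k = 1..r. weyl_vector r k) \<le> (\<Sum>k = 1..r. e k * ?v (p k))"
    by (simp add: inner_vec_def \<xi> sum_subtractf)
  then have loss: "(\<Sum>k = 1..r. (1 - e k) * ?v (p k)) \<le> 2"
    using sum_v sum_vp by (simp add: left_diff_distrib sum_subtractf)
  have neg: "p k = r" if "k \<in> {1..r}" "e k = - 1" for k
  proof (rule small)
    have "0 \<le> (1 - e j) * ?v (p j)" for j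
      using e(1)[of j] v_nonneg[of "p j"] by auto
    then have "(1 - e k) * ?v (p k) \<le> (\<Sum>k = 1..r. (1 - e k) * ?v (p k))"
      using that(1) by (intro member_le_sum) auto
    then show "?v (p k) < 2" using loss that(2) by simp
    show "p k \<in> {1..r}" using that(1) p_in by simp
  qed
  \<comment> \<open>Only one index is sent to \<open>r\<close>, so a sign change would be the only one, contrary to evenness.\<close>
  have e_one: "e k = 1" for k
  proof (rule ccontr)
    assume "e k \<noteq> 1"
    then have k: "k \<in> {1..r}" "e k = - 1" using e by blast+
    have "e j = 1" if "j \<in> {1..r} - {k}" for j
      using neg[of j] neg[OF k] permutes_inj[OF p] e(1)[of j] that
      by (metis Diff_iff injD singletonI)
    then have "prod e {1..r} = e k"
      using k(1) by (simp add: prod.remove[of _ k])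
    then show False using e(3) k(2) by simp
  qed
  then have \<sigma>_eq: "\<sigma> = (\<lambda>x. x \<circ> p)" and \<xi>': "\<xi> k = ?v (p k) - weyl_vector r k" for k
    by (auto simp: \<sigma> \<xi> fun_eq_iff)

  \<comment> \<open>Negating the last coordinate turns the total \<open>2\<close> into \<open>2 - 2 \<xi>\<^sub>r\<close>, and \<open>\<xi>\<^sub>r\<close> is the last coordinate
    of \<open>\<sigma> (\<lambda> + \<rho>)\<close> because \<open>\<rho>\<^sub>r = 0\<close>.\<close>
  have "0 \<le> inner_vec r (\<lambda>k. if k = r then - 1 else 1) \<xi>"
    using part by (rule inner_dominant_nonneg) auto
  also have "inner_vec r (\<lambda>k. if k = r then - 1 else 1) \<xi> =
      (\<Sum>k = 1..r. \<xi> k - (if k = r then 2 * \<xi> r else 0))"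
    unfolding inner_vec_def by (rule sum.cong) auto
  also have "\<dots> = (\<Sum>k = 1..r. \<xi> k) - 2 * \<xi> r"
    using r by (simp add: sum_subtractf)
  also have "\<dots> = 2 - 2 * ?v (p r)"
    using sum_v sum_vp by (simp add: \<xi>' sum_subtractf weyl_vector_apply)
  finally have "?v (p r) < 2" by simp
  then have pr: "p r = r" using small p_in r by simp

  have partial: "(\<Sum>k = 1..m. weyl_vector r k) \<le> (\<Sum>k = 1..m. ?v (p k))" if "m \<le> r" for m
  proof -
    have "0 \<le> inner_vec r (\<lambda>k. if k \<le> m then 1 else 0) \<xi>"
      using part by (rule inner_dominant_nonneg) auto
    also have "\<dots> = (\<Sum>k = 1..m. \<xi> k)"
      unfolding inner_vec_def using that by (intro sum.mono_neutral_cong_right) auto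
    finally show ?thesis by (simp add: \<xi>' sum_subtractf)
  qed
  \<comment> \<open>All coordinates of \<open>\<lambda> + \<rho>\<close> except the first are at most \<open>r - 2\<close>. Keeping the first one in place
    makes the partial sums of \<open>\<lambda> + \<rho>\<close> exceed those of \<open>\<rho>\<close> by \<open>1\<close>, which is the allowance below.\<close>
  have "real (r - 1) \<le> ?v (p 1)"
    using partial[of 1] r by (simp add: weyl_vector_apply)
  then have p1: "p 1 = 1"
    using r by (auto simp: v of_nat_diff split: if_splits)
  have "p permutes {2..r - 1}"
    using p
  proof (rule permutes_superset)
    fix x assume "x \<in> {1..r} - {2..r - 1}"
    then have "x = 1 \<or> x = r" by auto
    then show "p x = x" using p1 pr by blast
  qed
  moreover have "(\<Sum>j = 2..m. ?v j) \<le> (\<Sum>j = 2..m. ?v (p j)) + 1" if m: "m \<le> r - 2" for m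
  proof (cases "m = 0")
    case False
    have "m \<le> r" using m by simp
    from False have split: "{1..m} = insert 1 {2..m}" by auto
    have "(\<Sum>j = 2..m. weyl_vector r j) = (\<Sum>j = 2..m. ?v j)"
      using m r by (intro sum.cong) (auto simp: v_rho)
    moreover have "?v 1 = weyl_vector r 1 + 1"
      using r by (simp add: v_rho)
    ultimately show ?thesis
      using partial[OF \<open>m \<le> r\<close>] p1 unfolding split by simp
  qed simp
  ultimately show ?thesis using that \<sigma>_eq by blast
qed

lemma permutation_of_three_cases:
  assumes "p permutes {a, a + 1, a + 2 :: nat}"
  defines "s \<equiv> transpose a (a + 1)" and "t \<equiv> transpose (a + 1) (a + 2)"
  shows "p \<in> {id, s, t, t \<circ> s, s \<circ> t, s \<circ> t \<circ> s}"
proof -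
  have inside: "p a \<in> {a, a + 1, a + 2}" "p (a + 1) \<in> {a, a + 1, a + 2}" "p (a + 2) \<in> {a, a + 1, a + 2}"
    unfolding permutes_in_image[OF assms(1)] by simp_all
  have distinct: "p a \<noteq> p (a + 1)" "p a \<noteq> p (a + 2)" "p (a + 1) \<noteq> p (a + 2)"
    using permutes_inj[OF assms(1)] by (simp_all add: inj_eq)
  have outside: "p x = x" if "x \<noteq> a" "x \<noteq> a + 1" "x \<noteq> a + 2" for x
    using that by (intro permutes_not_in[OF assms(1)]) simp
  have eqI: "p = q" if "p a = q a" "p (a + 1) = q (a + 1)" "p (a + 2) = q (a + 2)"
    "\<And>x. x \<noteq> a \<Longrightarrow> x \<noteq> a + 1 \<Longrightarrow> x \<noteq> a + 2 \<Longrightarrow> q x = x" for q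
  proof
    fix x
    show "p x = q x"
      using that outside[of x] by (cases "x = a \<or> x = a + 1 \<or> x = a + 2") auto
  qed
  have "p a = a \<and> p (a + 1) = a + 1 \<and> p (a + 2) = a + 2
    \<or> p a = a \<and> p (a + 1) = a + 2 \<and> p (a + 2) = a + 1
    \<or> p a = a + 1 \<and> p (a + 1) = a \<and> p (a + 2) = a + 2
    \<or> p a = a + 1 \<and> p (a + 1) = a + 2 \<and> p (a + 2) = a
    \<or> p a = a + 2 \<and> p (a + 1) = a \<and> p (a + 2) = a + 1
    \<or> p a = a + 2 \<and> p (a + 1) = a + 1 \<and> p (a + 2) = a"
    using inside distinct unfolding insert_iff empty_iff by (elim disjE) simp_all
  then consider "p a = a" "p (a + 1) = a + 1" "p (a + 2) = a + 2"
    | "p a = a" "p (a + 1) = a + 2" "p (a + 2) = a + 1"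
    | "p a = a + 1" "p (a + 1) = a" "p (a + 2) = a + 2"
    | "p a = a + 1" "p (a + 1) = a + 2" "p (a + 2) = a"
    | "p a = a + 2" "p (a + 1) = a" "p (a + 2) = a + 1"
    | "p a = a + 2" "p (a + 1) = a + 1" "p (a + 2) = a"
    by (elim disjE conjE)
  then show ?thesis
  proof cases
    case 1
    then have "p = id" by (intro eqI) auto
    then show ?thesis by simp
  next
    case 2
    then have "p = t" by (intro eqI) (auto simp: t_def transpose_def)
    then show ?thesis by simp
  next
    case 3
    then have "p = s" by (intro eqI) (auto simp: s_def transpose_def)
    then show ?thesis by simp
  next
    case 4
    then have "p = s \<circ> t" by (intro eqI) (auto simp: s_def t_def transpose_def)
    then show ?thesis by simp
  next
    case 5
    then have "p = t \<circ> s" by (intro eqI) (auto simp: s_def t_def transpose_def)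
    then show ?thesis by simp
  next
    case 6
    then have "p = s \<circ> t \<circ> s" by (intro eqI) (auto simp: s_def t_def transpose_def)
    then show ?thesis by simp
  qed
qed

text \<open>
  A permutation \<open>p\<close> acts on coordinates by \<open>x \<mapsto> x \<circ> p\<close>, so a reflection at the left end of a word
  composes with \<open>p\<close> on the right.
\<close>
lemma permutation_action_peel:
  assumes "1 \<le> i" "i < r" "(\<lambda>x :: vect. x \<circ> (p \<circ> transpose i (i + 1))) = \<tau>"
  shows "(\<lambda>x. x \<circ> p) = simple_reflection r i \<circ> \<tau>"
proof
  fix x :: vect
  have "simple_reflection r i (\<tau> x) = \<tau> x \<circ> transpose i (i + 1)"
    using simple_reflection_transpose[OF assms(1,2)] by simp
  also have "\<dots> = x \<circ> p"
    unfolding assms(3)[symmetric] by (simp add: fun_eq_iff)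
  finally show "x \<circ> p = (simple_reflection r i \<circ> \<tau>) x" by simp
qed

text \<open>
  The scan from the left over the places \<open>k, \<dots>, r - 1\<close>: a fixed place is skipped, and an exchange of
  neighbours is split off as the first letter of the word. The second alternative records \<open>k + 3 \<le> r\<close>, which
  says that the whole exceptional block \<open>r - 3, r - 2, r - 1\<close> is still ahead; after an exchange
  at \<open>k\<close> this is applied to \<open>k + 2\<close> and gives the bound \<open>k \<le> r - 5\<close>.
\<close>
lemma small_deficit_words:
  assumes r: "4 \<le> r"
    and "2 \<le> k" "k \<le> r - 1" "p permutes {k..r - 1}"
    and "\<And>m. m \<le> r - 2 \<Longrightarrow>
       (\<Sum>j = k..m. shifted_weight r j) \<le> (\<Sum>j = k..m. shifted_weight r (p j)) + 1"
  shows "(\<exists>js. set js \<subseteq> {k..r - 2} \<and> nonconsecutive js \<and> (\<lambda>x. x \<circ> p) = reflection_word r js) \<or>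
    (k + 3 \<le> r \<and> (\<exists>js \<pi>. set js \<subseteq> {k..r - 5} \<and> nonconsecutive js \<and>
        \<pi> \<in> {reflection_word r [r - 3, r - 2],
             reflection_word r [r - 2, r - 3],
             reflection_word r [r - 3, r - 2, r - 3]} \<and>
        (\<lambda>x. x \<circ> p) = reflection_word r js \<circ> \<pi>))"
    (is "?plain k p \<or> ?exc k p")
  using assms(2-)
proof (induction "r - k" arbitrary: k p rule: less_induct)
  case less
  let ?v = "shifted_weight r"
  note k = \<open>2 \<le> k\<close> \<open>k \<le> r - 1\<close> and p = \<open>p permutes {k..r - 1}\<close> and deficit = less.prems(4)
  have v: "?v j = (if j = r - 1 then 2 else real (r - j))" if "2 \<le> j" "j \<le> r - 1" for j
    using that r by (auto simp: shifted_weight_apply)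
  have p_in: "p j \<in> {k..r - 1}" if "j \<in> {k..r - 1}" for j
    using permutes_in_image[OF p] that by blast
  have id_plain: "?plain k id"
    by (rule exI[of _ "[]"]) (auto simp: reflection_word_Nil nonconsecutive_Nil fun_eq_iff)
  consider "k = r - 1" | "k = r - 2" | "k = r - 3" | "k + 3 < r"
    using k r by linarith
  then show ?case
  proof cases
    case 1
    then have "p permutes {k}" using p by simp
    then have "p = id" by simp
    then show ?thesis using id_plain by simp
  next
    case 2
    then have "r - 1 = Suc k" using k by linarith
    then have "p permutes {k, k + 1}" using p by (simp add: atLeastAtMostSuc_conv insert_commute)
    then have "p = id \<or> p = transpose k (k + 1)"
      by (simp add: permutes_doubleton_iff)
    moreover have "?plain k (transpose k (k + 1))"
      using 2 k by (intro exI[of _ "[k]"])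
        (auto simp: reflection_word_Nil reflection_word_Cons nonconsecutive_Nil nonconsecutive_Cons
          simple_reflection_transpose fun_eq_iff)
    ultimately show ?thesis using id_plain by blast
  next
    case 3
    then have idx: "r - 1 = k + 2" "r - 2 = k + 1" "r - 3 = k" "k + 3 = r" using k by linarith+
    have "{k..k + 2} = {k, k + 1, k + 2}" by auto
    then have "p permutes {k, k + 1, k + 2}" using p idx by simp
    then have six: "p \<in> {id, transpose k (k + 1), transpose (k + 1) (k + 2),
      transpose (k + 1) (k + 2) \<circ> transpose k (k + 1),
      transpose k (k + 1) \<circ> transpose (k + 1) (k + 2),
      transpose k (k + 1) \<circ> transpose (k + 1) (k + 2) \<circ> transpose k (k + 1)}"
      by (rule permutation_of_three_cases)
    \<comment> \<open>Composing reflections composes the permutations of indices in the opposite order.\<close>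
    have word: "reflection_word r [k] = (\<lambda>x. x \<circ> transpose k (k + 1))"
      "reflection_word r [k + 1] = (\<lambda>x. x \<circ> transpose (k + 1) (k + 2))"
      "reflection_word r [k, k + 1] = (\<lambda>x. x \<circ> (transpose (k + 1) (k + 2) \<circ> transpose k (k + 1)))"
      "reflection_word r [k + 1, k] = (\<lambda>x. x \<circ> (transpose k (k + 1) \<circ> transpose (k + 1) (k + 2)))"
      "reflection_word r [k, k + 1, k] =
        (\<lambda>x. x \<circ> (transpose k (k + 1) \<circ> transpose (k + 1) (k + 2) \<circ> transpose k (k + 1)))"
      using k idx by (auto simp: reflection_word_Nil reflection_word_Cons
          simple_reflection_transpose fun_eq_iff)
    have plain: "?plain k p" if "(\<lambda>x. x \<circ> p) = reflection_word r [j]" "j \<in> {k, k + 1}" for j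
    proof -
      have "set [j] \<subseteq> {k..r - 2} \<and> nonconsecutive [j]"
        using that(2) idx by (auto simp: nonconsecutive_Nil nonconsecutive_Cons)
      then show ?thesis using that(1) by blast
    qed
    have exc: "?exc k p" if "(\<lambda>x. x \<circ> p) = \<pi>" "\<pi> \<in> {reflection_word r [r - 3, r - 2],
             reflection_word r [r - 2, r - 3],
             reflection_word r [r - 3, r - 2, r - 3]}" for \<pi>
      using that idx(4) by (intro conjI exI[of _ "[]"] exI[of _ \<pi>])
        (auto simp: nonconsecutive_Nil reflection_word_Nil)
    from six have "p = id \<or> (\<lambda>x. x \<circ> p) = reflection_word r [k] \<or>
        (\<lambda>x. x \<circ> p) = reflection_word r [k + 1] \<or>
        (\<lambda>x. x \<circ> p) = reflection_word r [k, k + 1] \<or>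
        (\<lambda>x. x \<circ> p) = reflection_word r [k + 1, k] \<or>
        (\<lambda>x. x \<circ> p) = reflection_word r [k, k + 1, k]"
      unfolding word by (elim insertE emptyE) simp_all
    then show ?thesis
    proof (elim disjE)
      assume "p = id"
      then show ?thesis using id_plain by simp
    qed (rule disjI1, erule plain, simp | rule disjI2, erule exc, simp add: idx)+
  next
    case 4
    have vk: "?v k = real r - real k" "?v (k + 1) = real r - real k - 1"
      using 4 k v[of k] v[of "k + 1"] by (auto simp: of_nat_diff)
    have v_less: "?v j < ?v (k + 1)" if "k + 2 \<le> j" "j \<le> r - 1" for j
      using that k 4 v[of j] v[of "k + 1"] by (auto simp: of_nat_diff)
    have pk_ge: "?v k \<le> ?v (p k) + 1"
      using deficit[of k] 4 by simp
    \<comment> \<open>The values decrease strictly up to place \<open>r - 2\<close>, so an allowance of \<open>1\<close> admits only the right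
      neighbour of \<open>k\<close> besides \<open>k\<close> itself.\<close>
    have pk: "p k = k \<or> p k = k + 1"
    proof (rule ccontr)
      assume "\<not> ?thesis"
      then have "k + 2 \<le> p k" "p k \<le> r - 1" using p_in[of k] k by auto
      then show False using v_less[of "p k"] pk_ge vk by simp
    qed
    show ?thesis
    proof (cases "p k = k")
      case True
      have "p permutes {k + 1..r - 1}"
        using p
      proof (rule permutes_superset)
        fix x assume "x \<in> {k..r - 1} - {k + 1..r - 1}"
        then have "x = k" by auto
        then show "p x = x" using True by simp
      qed
      moreover have "(\<Sum>j = k + 1..m. ?v j) \<le> (\<Sum>j = k + 1..m. ?v (p j)) + 1" if "m \<le> r - 2" for m
      proof (cases "k \<le> m")
        case le: True
        then have "{k..m} = insert k {k + 1..m}" by auto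
        then show ?thesis using deficit[OF that] True by simp
      qed simp
      ultimately have "?plain (k + 1) p \<or> ?exc (k + 1) p"
        using 4 k by (intro less.hyps) auto
      moreover have "{k + 1..r - 2} \<subseteq> {k..r - 2}" "{k + 1..r - 5} \<subseteq> {k..r - 5}" by auto
      ultimately show ?thesis using 4 by (meson order_trans less_imp_le)
    next
      case False
      then have pk': "p k = k + 1" using pk by blast
      \<comment> \<open>The allowance is used up at \<open>k\<close>, so the value placed at \<open>k + 1\<close> may not be
      smaller than the original one there.\<close>
      have k1_le: "k + 1 \<le> r - 2" using 4 by simp
      then have "?v (k + 1) \<le> ?v (p (k + 1))"
        using deficit[OF k1_le] vk by (simp add: pk')
      moreover have "p (k + 1) \<in> {k..r - 1}" using p_in[of "k + 1"] 4 by auto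
      moreover have "p (k + 1) \<noteq> k + 1"
        using permutes_inj[OF p] pk' by (metis injD n_not_Suc_n Suc_eq_plus1)
      moreover have "\<not> (k + 2 \<le> p (k + 1) \<and> p (k + 1) \<le> r - 1)"
        using calculation(1) v_less[of "p (k + 1)"] by force
      ultimately have pk1: "p (k + 1) = k"
        unfolding atLeastAtMost_iff by linarith
      define q where "q = p \<circ> transpose k (k + 1)"
      have q_same: "q j = p j" if "k + 2 \<le> j" for j
        using that by (simp add: q_def transpose_def)
      have qk: "q k = k" "q (k + 1) = k + 1"
        using pk' pk1 by (simp_all add: q_def)
      have "q permutes {k..r - 1}"
        unfolding q_def using 4 by (intro permutes_compose[OF _ p] permutes_swap_id) auto
      then have "q permutes {k + 2..r - 1}"
      proof (rule permutes_superset)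
        fix x assume "x \<in> {k..r - 1} - {k + 2..r - 1}"
        then have "x = k \<or> x = k + 1" by auto
        then show "q x = x" using qk by blast
      qed
      moreover have "(\<Sum>j = k + 2..m. ?v j) \<le> (\<Sum>j = k + 2..m. ?v (q j)) + 1" if "m \<le> r - 2" for m
      proof (cases "k + 1 \<le> m")
        case le: True
        then have "{k..m} = insert k (insert (k + 1) {k + 2..m})" by auto
        then show ?thesis using deficit[OF that] pk' pk1 by (simp add: q_same)
      qed simp
      ultimately have IH: "?plain (k + 2) q \<or> ?exc (k + 2) q"
        using 4 k by (intro less.hyps) auto
      have peel: "(\<lambda>x. x \<circ> p) = simple_reflection r k \<circ> \<tau>" if "(\<lambda>x. x \<circ> q) = \<tau>" for \<tau>
        using that k 4 unfolding q_def by (intro permutation_action_peel) auto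
      have nc: "nonconsecutive (k # js)" if "nonconsecutive js" "set js \<subseteq> {k + 2..n}" for js n
        using that by (auto simp: nonconsecutive_Cons)
      from IH show ?thesis
      proof
        assume "?plain (k + 2) q"
        then obtain js where js: "set js \<subseteq> {k + 2..r - 2}" "nonconsecutive js"
          "(\<lambda>x. x \<circ> q) = reflection_word r js" by blast
        have "set (k # js) \<subseteq> {k..r - 2}" using js(1) 4 by auto
        moreover have "(\<lambda>x. x \<circ> p) = reflection_word r (k # js)"
          using peel[OF js(3)] by (simp only: reflection_word_Cons)
        ultimately have "?plain k p"
          using nc[OF js(2,1)] by blast
        then show ?thesis by blast
      next
        assume "?exc (k + 2) q"
        then obtain js \<pi> where js: "k + 2 + 3 \<le> r" "set js \<subseteq> {k + 2..r - 5}" "nonconsecutive js"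
          "\<pi> \<in> {reflection_word r [r - 3, r - 2], reflection_word r [r - 2, r - 3],
             reflection_word r [r - 3, r - 2, r - 3]}"
          "(\<lambda>x. x \<circ> q) = reflection_word r js \<circ> \<pi>" by blast
        have "set (k # js) \<subseteq> {k..r - 5}" using js(1,2) by auto
        moreover have "(\<lambda>x. x \<circ> p) = reflection_word r (k # js) \<circ> \<pi>"
          using peel[OF js(5)] by (simp add: reflection_word_Cons o_assoc)
        moreover have "k + 3 \<le> r" using 4 by simp
        ultimately have "?exc k p"
          using js(4) nc[OF js(3,2)] by blast
        then show ?thesis by blast
      qed
    qed
  qed
qed

section \<open>The alternation set\<close>

theorem theorem4p1:
  fixes r :: nat and \<sigma> :: "vect \<Rightarrow> vect"
  assumes "r \<ge> 4"
  shows "\<sigma> \<in> weyl_alternation_set r (\<Sum>i = 1..r. simple_root r i) 0 \<longleftrightarrow>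
    \<sigma> = id \<or>
    (\<exists>js. js \<noteq> [] \<and> set js \<subseteq> {2..r - 2} \<and> nonconsecutive js \<and> \<sigma> = reflection_word r js) \<or>
    (r \<ge> 5 \<and>
     (\<exists>js \<pi>. set js \<subseteq> {2..r - 5} \<and> nonconsecutive js \<and>
        \<pi> \<in> {reflection_word r [r - 3, r - 2],
             reflection_word r [r - 2, r - 3],
             reflection_word r [r - 3, r - 2, r - 3]} \<and>
        \<sigma> = reflection_word r js \<circ> \<pi>))"
    (is "?mem \<longleftrightarrow> ?one \<or> ?plain \<or> ?exc")
proof
  assume ?mem
  then obtain p where p: "\<sigma> = (\<lambda>x. x \<circ> p)" "p permutes {2..r - 1}"
    "\<And>m. m \<le> r - 2 \<Longrightarrow>
       (\<Sum>j = 2..m. shifted_weight r j) \<le> (\<Sum>j = 2..m. shifted_weight r (p j)) + 1"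
    using alternation_permutation[OF assms] by blast
  have "2 \<le> r - 1" using assms by simp
  have five: "2 + 3 = (5 :: nat)" by simp
  from small_deficit_words[OF assms order_refl \<open>2 \<le> r - 1\<close> p(2,3), folded p(1), unfolded five]
  show "?one \<or> ?plain \<or> ?exc"
  proof
    assume "\<exists>js. set js \<subseteq> {2..r - 2} \<and> nonconsecutive js \<and> \<sigma> = reflection_word r js"
    then show ?thesis
      by (metis reflection_word_Nil)
  next
    assume ?exc
    then show ?thesis by (intro disjI2)
  qed
next
  assume "?one \<or> ?plain \<or> ?exc"
  moreover have "?one \<Longrightarrow> ?mem"
    using nonconsecutive_word_in_alternation_set[OF assms, of "[]"]
    by (simp add: reflection_word_Nil nonconsecutive_Nil)
  ultimately show ?mem
    using nonconsecutive_word_in_alternation_set[OF assms] exceptional_word_in_alternation_set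
    by blast
qed

end
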